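(* Let $(G,m,u,\iota)$ be a group object in a Cartesian tangent category such that the pullback $T(G)_u$ of $p_G:T(G)\to G$ along $u:1\to G$ exists. Let $\phi^{-1}=(0\times p_u^* )T(m):G\times T(G)_u\to T(G)$ and let $s=\langle\pi_1,\mathrm{Ad}_r\rangle:T(G)_u\times G\to G\times T(G)_u$. Then $$(\phi^{-1}\times\phi^{-1})\,T(m)=(1\times s\times1)\,(m\times T(m)_u)\,\phi^{-1}:G\times T(G)_u\times G\times T(G)_u\to T(G),$$ where $T(m)_u:T(G)_u\times T(G)_u\to T(G)_u$ is induced by the multiplication $T(m):T(G)\times T(G)\to T(G)$.
   Context: Composition is written in diagrammatic order: $fg$ means first $f$, then $g$. Tangent category $(\mathbb X,T,p,0,+,\ell,c)$: a category $\mathbb X$ with a functor $T:\mathbb X\to\mathbb X$ and a natural transformation $p:T\to 1$ such that the pullback powers $T_n(M)$ of $p_M$ ($n$-fold fibre products of $T(M)$ over $M$) exist for all objects $M$ and are preserved by $T$; natural transformations $+:T_2\to T$, $0:1\to T$ making each $p_M$ an additive bundle (a commutative monoid over $M$: $+p=\pi_0p=\pi_1p$, $0p=1$, $+$ associative, commutative, with unit $0$); a natural transformation $\ell:T\to T^2$ such that $(\ell_M,0_M):(p_M,+_M,0_M)\to(T(p_M),T(+_M),T(0_M))$ is an additive bundle morphism (commutes with projections, additions and zeros); a natural transformation $c:T^2\to T^2$ with $c^2=1$, $\ell c=\ell$ such that $(c_M,1):(T(p_M),T(+_M),T(0_M))\to(p_{TM},+_{TM},0_{TM})$ is an additive bundle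 morphism; such that $\ell T(\ell)=\ell\,\ell_T$, $T(c)\,c_T\,T(c)=c_T\,T(c)\,c_T$, $\ell_T\,T(c)\,c_T=c\,T(\ell)$, and $\langle\pi_0\ell,\pi_1 0_T\rangle T(+):T_2M\to T^2M$ is the equalizer of $T(p)$ and $T(p)p0:T^2M\to TM$. Cartesian tangent category: a tangent category with all finite products (terminal object $1$) such that the product functor, with the natural isomorphism $T(A)\times T(B)\cong T(A\times B)$, is a strong morphism of tangent categories (the canonical comparison maps are isomorphisms compatible with $p,0,+,\ell,c$). These identifications are suppressed, so e.g. $T(m):T(G)\times T(G)\to T(G)$. $!$ is the unique map to $1$; $f\times g=\langle\pi_0f,\pi_1g\rangle$; $p_u^*:T(G)_u\to T(G)$ is the pullback projection; for $h:X\to T(G)$ with $hp=!u$, $\langle !,h\rangle:X\to T(G)_u$ is the unique map with $\langle !,h\rangle p_u^*=h$. $m_3=(m\times1)m:G\times G\times G\to G$. The adjoint right action is $\mathrm{Ad}_r=\langle !,\langle\pi_1\iota0,\pi_0p_u^*,\pi_10\rangle T(m_3)\rangle:T(G)_u\times G\to T(G)_u$. $T(m)_u$ is the unique map with $T(m)_up_u^*=(p_u^*\times p_u^* )T(m)$. *)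

theory Defs
  imports Main
begin

section \<open>Categories\<close>

text \<open>
  Composition is diagrammatic: \<open>f \<cdot> g\<close> is first \<open>f\<close>, then \<open>g\<close>. Nothing is assumed about the
  operations outside \<open>Obj\<close> and \<open>Arr\<close>, or about \<open>f \<cdot> g\<close> when \<open>f\<close> and \<open>g\<close> are not composable.
\<close>

record ('o, 'a) category_data =
  Obj :: "'o set"
  Arr :: "'a set"
  Dom :: "'a \<Rightarrow> 'o"
  Cod :: "'a \<Rightarrow> 'o"
  Id :: "'o \<Rightarrow> 'a"  ("\<id>\<index>")
  Comp :: "'a \<Rightarrow> 'a \<Rightarrow> 'a"  (infixl "\<cdot>\<index>" 70)

definition hom :: "('o, 'a, 'm) category_data_scheme \<Rightarrow> 'o \<Rightarrow> 'o \<Rightarrow> 'a set"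
  where "hom C A B = {f \<in> Arr C. Dom C f = A \<and> Cod C f = B}"

locale category =
  fixes C :: "('o, 'a, 'm) category_data_scheme" (structure)
  assumes dom_obj: "f \<in> Arr C \<Longrightarrow> Dom C f \<in> Obj C"
    and cod_obj: "f \<in> Arr C \<Longrightarrow> Cod C f \<in> Obj C"
    and id_hom: "A \<in> Obj C \<Longrightarrow> \<id> A \<in> hom C A A"
    and comp_hom: "\<lbrakk>f \<in> hom C A B; g \<in> hom C B D\<rbrakk> \<Longrightarrow> f \<cdot> g \<in> hom C A D"
    and id_comp: "f \<in> hom C A B \<Longrightarrow> \<id> A \<cdot> f = f"
    and comp_id: "f \<in> hom C A B \<Longrightarrow> f \<cdot> \<id> B = f"
    and comp_assoc: "\<lbrakk>f \<in> hom C A B; g \<in> hom C B D; h \<in> hom C D E\<rbrakk>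
      \<Longrightarrow> (f \<cdot> g) \<cdot> h = f \<cdot> (g \<cdot> h)"

definition inverse_arrows :: "('o, 'a, 'm) category_data_scheme \<Rightarrow> 'a \<Rightarrow> 'a \<Rightarrow> bool"
  where "inverse_arrows C f g \<longleftrightarrow>
    f \<in> Arr C \<and> g \<in> hom C (Cod C f) (Dom C f) \<and>
    f \<cdot> g = \<id> (Dom C f) \<and> g \<cdot> f = \<id> (Cod C f)"
  for C (structure)

definition iso :: "('o, 'a, 'm) category_data_scheme \<Rightarrow> 'a \<Rightarrow> bool"
  where "iso C f \<longleftrightarrow> (\<exists>g. inverse_arrows C f g)"

definition inverse_of :: "('o, 'a, 'm) category_data_scheme \<Rightarrow> 'a \<Rightarrow> 'a"
  where "inverse_of C f = (THE g. inverse_arrows C f g)"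

definition is_functor ::
    "('o, 'a, 'm) category_data_scheme \<Rightarrow> ('o \<Rightarrow> 'o) \<Rightarrow> ('a \<Rightarrow> 'a) \<Rightarrow> bool"
  where "is_functor C Fo Fa \<longleftrightarrow>
    (\<forall>A\<in>Obj C. Fo A \<in> Obj C \<and> Fa (\<id> A) = \<id> (Fo A)) \<and>
    (\<forall>A B f. f \<in> hom C A B \<longrightarrow> Fa f \<in> hom C (Fo A) (Fo B)) \<and>
    (\<forall>A B D f g. f \<in> hom C A B \<longrightarrow> g \<in> hom C B D \<longrightarrow> Fa (f \<cdot> g) = Fa f \<cdot> Fa g)"
  for C (structure)

definition is_nat_trans ::
    "('o, 'a, 'm) category_data_scheme \<Rightarrow> ('o \<Rightarrow> 'o) \<Rightarrow> ('a \<Rightarrow> 'a) \<Rightarrow>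
      ('o \<Rightarrow> 'o) \<Rightarrow> ('a \<Rightarrow> 'a) \<Rightarrow> ('o \<Rightarrow> 'a) \<Rightarrow> bool"
  where "is_nat_trans C Fo Fa Go Ga \<alpha> \<longleftrightarrow>
    (\<forall>A\<in>Obj C. \<alpha> A \<in> hom C (Fo A) (Go A)) \<and>
    (\<forall>A B f. f \<in> hom C A B \<longrightarrow> Fa f \<cdot> \<alpha> B = \<alpha> A \<cdot> Ga f)"
  for C (structure)

definition is_terminal :: "('o, 'a, 'm) category_data_scheme \<Rightarrow> 'o \<Rightarrow> bool"
  where "is_terminal C U \<longleftrightarrow> U \<in> Obj C \<and> (\<forall>A\<in>Obj C. \<exists>!f. f \<in> hom C A U)"

definition is_product ::
    "('o, 'a, 'm) category_data_scheme \<Rightarrow> 'o \<Rightarrow> 'o \<Rightarrow> 'o \<Rightarrow> 'a \<Rightarrow> 'a \<Rightarrow> bool"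
  where "is_product C A B P a b \<longleftrightarrow>
    P \<in> Obj C \<and> a \<in> hom C P A \<and> b \<in> hom C P B \<and>
    (\<forall>X x y. x \<in> hom C X A \<longrightarrow> y \<in> hom C X B \<longrightarrow>
      (\<exists>!h. h \<in> hom C X P \<and> h \<cdot> a = x \<and> h \<cdot> b = y))"
  for C (structure)

definition is_pullback ::
    "('o, 'a, 'm) category_data_scheme \<Rightarrow> 'a \<Rightarrow> 'a \<Rightarrow> 'o \<Rightarrow> 'a \<Rightarrow> 'a \<Rightarrow> bool"
  where "is_pullback C f g P a b \<longleftrightarrow>
    f \<in> Arr C \<and> g \<in> Arr C \<and> Cod C f = Cod C g \<and>
    P \<in> Obj C \<and> a \<in> hom C P (Dom C f) \<and> b \<in> hom C P (Dom C g) \<and> a \<cdot> f = b \<cdot> g \<and>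
    (\<forall>X x y. x \<in> hom C X (Dom C f) \<longrightarrow> y \<in> hom C X (Dom C g) \<longrightarrow> x \<cdot> f = y \<cdot> g \<longrightarrow>
      (\<exists>!h. h \<in> hom C X P \<and> h \<cdot> a = x \<and> h \<cdot> b = y))"
  for C (structure)

text \<open>
  The \<open>n\<close>-fold fibre product of \<open>f\<close> over its codomain, with projections \<open>\<pi> i\<close> for \<open>i < n\<close>. The
  common composite \<open>b = \<pi> i \<cdot> f\<close> is part of the cone, so that \<open>n = 0\<close> yields the codomain of \<open>f\<close>.
\<close>

definition is_fibre_power ::
    "('o, 'a, 'm) category_data_scheme \<Rightarrow> nat \<Rightarrow> 'a \<Rightarrow> 'o \<Rightarrow> 'a \<Rightarrow> (nat \<Rightarrow> 'a) \<Rightarrow> bool"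
  where "is_fibre_power C n f P b \<pi> \<longleftrightarrow>
    f \<in> Arr C \<and> P \<in> Obj C \<and> b \<in> hom C P (Cod C f) \<and>
    (\<forall>i<n. \<pi> i \<in> hom C P (Dom C f) \<and> \<pi> i \<cdot> f = b) \<and>
    (\<forall>X y x. y \<in> hom C X (Cod C f) \<longrightarrow> (\<forall>i<n. x i \<in> hom C X (Dom C f) \<and> x i \<cdot> f = y) \<longrightarrow>
      (\<exists>!h. h \<in> hom C X P \<and> h \<cdot> b = y \<and> (\<forall>i<n. h \<cdot> \<pi> i = x i)))"
  for C (structure)

definition is_equalizer :: "('o, 'a, 'm) category_data_scheme \<Rightarrow> 'a \<Rightarrow> 'a \<Rightarrow> 'a \<Rightarrow> bool"
  where "is_equalizer C f g e \<longleftrightarrow>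
    f \<in> Arr C \<and> g \<in> hom C (Dom C f) (Cod C f) \<and>
    e \<in> Arr C \<and> Cod C e = Dom C f \<and> e \<cdot> f = e \<cdot> g \<and>
    (\<forall>X x. x \<in> hom C X (Dom C f) \<longrightarrow> x \<cdot> f = x \<cdot> g \<longrightarrow>
      (\<exists>!h. h \<in> hom C X (Dom C e) \<and> h \<cdot> e = x))"
  for C (structure)

text \<open>
  The map \<open>\<langle>x, y\<rangle>\<close> into a product or pullback \<open>P\<close> with projections \<open>a\<close> and \<open>b\<close>.
\<close>

definition tuple ::
    "('o, 'a, 'm) category_data_scheme \<Rightarrow> 'o \<Rightarrow> 'a \<Rightarrow> 'a \<Rightarrow> 'a \<Rightarrow> 'a \<Rightarrow> 'a"
  where "tuple C P a b x y = (THE h. h \<in> hom C (Dom C x) P \<and> h \<cdot> a = x \<and> h \<cdot> b = y)"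
  for C (structure)

definition factor :: "('o, 'a, 'm) category_data_scheme \<Rightarrow> 'a \<Rightarrow> 'a \<Rightarrow> 'a"
  where "factor C e h = (THE k. k \<in> hom C (Dom C h) (Dom C e) \<and> k \<cdot> e = h)"
  for C (structure)


section \<open>Additive bundles\<close>

text \<open>
  A commutative monoid \<open>(q, s, z)\<close> over \<open>M\<close>, with \<open>s\<close> defined on the fibre product \<open>E\<^sub>2\<close> of \<open>q\<close> with
  itself, whose projections are \<open>a\<close> and \<open>b\<close>. The monoid laws are stated on generalized elements.
\<close>

definition additive_bundle ::
    "('o, 'a, 'm) category_data_scheme \<Rightarrow> 'a \<Rightarrow> 'o \<Rightarrow> 'a \<Rightarrow> 'a \<Rightarrow> 'a \<Rightarrow> 'a \<Rightarrow> bool"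
  where "additive_bundle C q E\<^sub>2 a b s z \<longleftrightarrow>
    (let E = Dom C q; M = Cod C q; add = (\<lambda>x y. tuple C E\<^sub>2 a b x y \<cdot> s) in
      is_pullback C q q E\<^sub>2 a b \<and> s \<in> hom C E\<^sub>2 E \<and> z \<in> hom C M E \<and>
      s \<cdot> q = a \<cdot> q \<and> s \<cdot> q = b \<cdot> q \<and> z \<cdot> q = \<id> M \<and>
      (\<forall>X x y w. x \<in> hom C X E \<longrightarrow> y \<in> hom C X E \<longrightarrow> w \<in> hom C X E \<longrightarrow>
        x \<cdot> q = y \<cdot> q \<longrightarrow> y \<cdot> q = w \<cdot> q \<longrightarrow>
        add (add x y) w = add x (add y w) \<and> add x y = add y x \<and>
        add (x \<cdot> q \<cdot> z) x = x \<and> add x (x \<cdot> q \<cdot> z) = x))"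
  for C (structure)

definition additive_bundle_morphism ::
    "('o, 'a, 'm) category_data_scheme \<Rightarrow> 'a \<Rightarrow> 'a \<Rightarrow>
      'a \<Rightarrow> 'o \<Rightarrow> 'a \<Rightarrow> 'a \<Rightarrow> 'a \<Rightarrow> 'a \<Rightarrow>
      'a \<Rightarrow> 'o \<Rightarrow> 'a \<Rightarrow> 'a \<Rightarrow> 'a \<Rightarrow> 'a \<Rightarrow> bool"
  where "additive_bundle_morphism C f g q E\<^sub>2 a b s z q' E\<^sub>2' a' b' s' z' \<longleftrightarrow>
    additive_bundle C q E\<^sub>2 a b s z \<and> additive_bundle C q' E\<^sub>2' a' b' s' z' \<and>
    f \<in> hom C (Dom C q) (Dom C q') \<and> g \<in> hom C (Cod C q) (Cod C q') \<and>
    f \<cdot> q' = q \<cdot> g \<and>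
    s \<cdot> f = tuple C E\<^sub>2' a' b' (a \<cdot> f) (b \<cdot> f) \<cdot> s' \<and>
    z \<cdot> f = g \<cdot> z'"
  for C (structure)


section \<open>Tangent categories\<close>

record ('o, 'a) tangent_data = "('o, 'a) category_data" +
  Tob :: "'o \<Rightarrow> 'o"  ("T\<^sub>o\<index>")
  Tar :: "'a \<Rightarrow> 'a"  ("T\<^sub>a\<index>")
  tproj :: "'o \<Rightarrow> 'a"  ("\<pp>\<index>")
  T2ob :: "'o \<Rightarrow> 'o"  ("T\<^sub>2\<index>")
  T2pr0 :: "'o \<Rightarrow> 'a"
  T2pr1 :: "'o \<Rightarrow> 'a"
  tzero :: "'o \<Rightarrow> 'a"  ("\<zero>\<index>")
  tplus :: "'o \<Rightarrow> 'a"  ("\<oplus>\<index>")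
  tlift :: "'o \<Rightarrow> 'a"  ("\<ll>\<index>")
  tflip :: "'o \<Rightarrow> 'a"  ("\<cc>\<index>")

definition T2ar :: "('o, 'a, 'm) tangent_data_scheme \<Rightarrow> 'a \<Rightarrow> 'a"
  where "T2ar C f =
    (let A = Dom C f; B = Cod C f in
      tuple C (T\<^sub>2 B) (T2pr0 C B) (T2pr1 C B) (T2pr0 C A \<cdot> T\<^sub>a f) (T2pr1 C A \<cdot> T\<^sub>a f))"
  for C (structure)

locale tangent_category = category C
  for C :: "('o, 'a, 'm) tangent_data_scheme" (structure) +
  assumes T_functor: "is_functor C T\<^sub>o T\<^sub>a"
    and p_natural: "is_nat_trans C T\<^sub>o T\<^sub>a (\<lambda>A. A) (\<lambda>f. f) \<pp>"
    and fibre_powers_exist: "M \<in> Obj C \<Longrightarrow> \<exists>P b \<pi>. is_fibre_power C n (\<pp> M) P b \<pi>"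
    and fibre_powers_preserved:
      "\<lbrakk>M \<in> Obj C; is_fibre_power C n (\<pp> M) P b \<pi>\<rbrakk>
        \<Longrightarrow> is_fibre_power C n (T\<^sub>a (\<pp> M)) (T\<^sub>o P) (T\<^sub>a b) (\<lambda>i. T\<^sub>a (\<pi> i))"
    and T2_pullback: "M \<in> Obj C \<Longrightarrow> is_pullback C (\<pp> M) (\<pp> M) (T\<^sub>2 M) (T2pr0 C M) (T2pr1 C M)"
    and zero_natural: "is_nat_trans C (\<lambda>A. A) (\<lambda>f. f) T\<^sub>o T\<^sub>a \<zero>"
    and plus_natural: "is_nat_trans C T\<^sub>2 (T2ar C) T\<^sub>o T\<^sub>a \<oplus>"
    and lift_natural: "is_nat_trans C T\<^sub>o T\<^sub>a (\<lambda>A. T\<^sub>o (T\<^sub>o A)) (\<lambda>f. T\<^sub>a (T\<^sub>a f)) \<ll>"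
    and flip_natural: "is_nat_trans C (\<lambda>A. T\<^sub>o (T\<^sub>o A)) (\<lambda>f. T\<^sub>a (T\<^sub>a f))
      (\<lambda>A. T\<^sub>o (T\<^sub>o A)) (\<lambda>f. T\<^sub>a (T\<^sub>a f)) \<cc>"
    and additive: "M \<in> Obj C \<Longrightarrow>
      additive_bundle C (\<pp> M) (T\<^sub>2 M) (T2pr0 C M) (T2pr1 C M) (\<oplus> M) (\<zero> M)"
    and lift_additive: "M \<in> Obj C \<Longrightarrow>
      additive_bundle_morphism C (\<ll> M) (\<zero> M)
        (\<pp> M) (T\<^sub>2 M) (T2pr0 C M) (T2pr1 C M) (\<oplus> M) (\<zero> M)
        (T\<^sub>a (\<pp> M)) (T\<^sub>o (T\<^sub>2 M)) (T\<^sub>a (T2pr0 C M)) (T\<^sub>a (T2pr1 C M)) (T\<^sub>a (\<oplus> M)) (T\<^sub>a (\<zero> M))"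
    and flip_additive: "M \<in> Obj C \<Longrightarrow>
      additive_bundle_morphism C (\<cc> M) (\<id> (T\<^sub>o M))
        (T\<^sub>a (\<pp> M)) (T\<^sub>o (T\<^sub>2 M)) (T\<^sub>a (T2pr0 C M)) (T\<^sub>a (T2pr1 C M)) (T\<^sub>a (\<oplus> M)) (T\<^sub>a (\<zero> M))
        (\<pp> (T\<^sub>o M)) (T\<^sub>2 (T\<^sub>o M)) (T2pr0 C (T\<^sub>o M)) (T2pr1 C (T\<^sub>o M)) (\<oplus> (T\<^sub>o M)) (\<zero> (T\<^sub>o M))"
    and flip_flip: "M \<in> Obj C \<Longrightarrow> \<cc> M \<cdot> \<cc> M = \<id> (T\<^sub>o (T\<^sub>o M))"
    and lift_flip: "M \<in> Obj C \<Longrightarrow> \<ll> M \<cdot> \<cc> M = \<ll> M"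
    and lift_lift: "M \<in> Obj C \<Longrightarrow> \<ll> M \<cdot> T\<^sub>a (\<ll> M) = \<ll> M \<cdot> \<ll> (T\<^sub>o M)"
    and flip_braid: "M \<in> Obj C \<Longrightarrow>
      T\<^sub>a (\<cc> M) \<cdot> \<cc> (T\<^sub>o M) \<cdot> T\<^sub>a (\<cc> M) = \<cc> (T\<^sub>o M) \<cdot> T\<^sub>a (\<cc> M) \<cdot> \<cc> (T\<^sub>o M)"
    and lift_flip_flip: "M \<in> Obj C \<Longrightarrow>
      \<ll> (T\<^sub>o M) \<cdot> T\<^sub>a (\<cc> M) \<cdot> \<cc> (T\<^sub>o M) = \<cc> M \<cdot> T\<^sub>a (\<ll> M)"
    and lift_universal: "M \<in> Obj C \<Longrightarrow>
      is_equalizer C (T\<^sub>a (\<pp> M)) (T\<^sub>a (\<pp> M) \<cdot> \<pp> M \<cdot> \<zero> M)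
        (tuple C (T\<^sub>o (T\<^sub>2 M)) (T\<^sub>a (T2pr0 C M)) (T\<^sub>a (T2pr1 C M))
           (T2pr0 C M \<cdot> \<ll> M) (T2pr1 C M \<cdot> \<zero> (T\<^sub>o M)) \<cdot> T\<^sub>a (\<oplus> M))"


section \<open>Cartesian tangent categories\<close>

record ('o, 'a) cartesian_tangent_data = "('o, 'a) tangent_data" +
  One :: 'o  ("\<one>\<index>")
  Prod :: "'o \<Rightarrow> 'o \<Rightarrow> 'o"  (infixr "\<otimes>\<index>" 75)
  Pr0 :: "'o \<Rightarrow> 'o \<Rightarrow> 'a"  ("\<pi>\<^sub>0\<index>")
  Pr1 :: "'o \<Rightarrow> 'o \<Rightarrow> 'a"  ("\<pi>\<^sub>1\<index>")

definition to_one :: "('o, 'a, 'm) cartesian_tangent_data_scheme \<Rightarrow> 'o \<Rightarrow> 'a"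
  where "to_one C A = (THE f. f \<in> hom C A \<one>)"
  for C (structure)

definition pair :: "('o, 'a, 'm) cartesian_tangent_data_scheme \<Rightarrow> 'a \<Rightarrow> 'a \<Rightarrow> 'a"
    ("\<langle>_,/ _\<rangle>\<index>")
  where "\<langle>f, g\<rangle> =
    (let A = Cod C f; B = Cod C g in tuple C (A \<otimes> B) (\<pi>\<^sub>0 A B) (\<pi>\<^sub>1 A B) f g)"
  for C (structure)

definition prod_arr :: "('o, 'a, 'm) cartesian_tangent_data_scheme \<Rightarrow> 'a \<Rightarrow> 'a \<Rightarrow> 'a"
    (infixr "\<otimes>\<^sub>a\<index>" 75)
  where "f \<otimes>\<^sub>a g =
    (let A = Dom C f; B = Dom C g in \<langle>\<pi>\<^sub>0 A B \<cdot> f, \<pi>\<^sub>1 A B \<cdot> g\<rangle>)"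
  for C (structure)

definition comparison :: "('o, 'a, 'm) cartesian_tangent_data_scheme \<Rightarrow> 'o \<Rightarrow> 'o \<Rightarrow> 'a"
  where "comparison C A B = \<langle>T\<^sub>a (\<pi>\<^sub>0 A B), T\<^sub>a (\<pi>\<^sub>1 A B)\<rangle>"
  for C (structure)

text \<open>
  The identification \<open>T(A) \<times> T(B) \<cong> T(A \<times> B)\<close>. It is written out below wherever it is usually
  suppressed.
\<close>

definition strength :: "('o, 'a, 'm) cartesian_tangent_data_scheme \<Rightarrow> 'o \<Rightarrow> 'o \<Rightarrow> 'a"
    ("\<kappa>\<index>")
  where "\<kappa> A B = inverse_of C (comparison C A B)"
  for C (structure)

text \<open>
  The product functor with \<open>\<kappa>\<close> is a strong morphism of tangent categories: \<open>\<kappa>\<close> is a natural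
  isomorphism, compatible with the tangent structure of the product category, which is computed
  componentwise. The product functor preserves limits in any case.
\<close>

locale cartesian_tangent_category = tangent_category C
  for C :: "('o, 'a, 'm) cartesian_tangent_data_scheme" (structure) +
  assumes terminal: "is_terminal C \<one>"
    and products: "\<lbrakk>A \<in> Obj C; B \<in> Obj C\<rbrakk>
      \<Longrightarrow> is_product C A B (A \<otimes> B) (\<pi>\<^sub>0 A B) (\<pi>\<^sub>1 A B)"
    and T_terminal: "iso C (to_one C (T\<^sub>o \<one>))"
    and T_products: "\<lbrakk>A \<in> Obj C; B \<in> Obj C\<rbrakk> \<Longrightarrow> iso C (comparison C A B)"
    and strength_natural: "\<lbrakk>f \<in> hom C A A'; g \<in> hom C B B'\<rbrakk>
      \<Longrightarrow> (T\<^sub>a f \<otimes>\<^sub>a T\<^sub>a g) \<cdot> \<kappa> A' B' = \<kappa> A B \<cdot> T\<^sub>a (f \<otimes>\<^sub>a g)"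
    and strength_proj: "\<lbrakk>A \<in> Obj C; B \<in> Obj C\<rbrakk> \<Longrightarrow> \<kappa> A B \<cdot> \<pp> (A \<otimes> B) = \<pp> A \<otimes>\<^sub>a \<pp> B"
    and strength_zero: "\<lbrakk>A \<in> Obj C; B \<in> Obj C\<rbrakk> \<Longrightarrow> (\<zero> A \<otimes>\<^sub>a \<zero> B) \<cdot> \<kappa> A B = \<zero> (A \<otimes> B)"
    and strength_plus: "\<lbrakk>A \<in> Obj C; B \<in> Obj C\<rbrakk>
      \<Longrightarrow> (\<oplus> A \<otimes>\<^sub>a \<oplus> B) \<cdot> \<kappa> A B =
        tuple C (T\<^sub>2 (A \<otimes> B)) (T2pr0 C (A \<otimes> B)) (T2pr1 C (A \<otimes> B))
          ((T2pr0 C A \<otimes>\<^sub>a T2pr0 C B) \<cdot> \<kappa> A B) ((T2pr1 C A \<otimes>\<^sub>a T2pr1 C B) \<cdot> \<kappa> A B)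
        \<cdot> \<oplus> (A \<otimes> B)"
    and strength_lift: "\<lbrakk>A \<in> Obj C; B \<in> Obj C\<rbrakk>
      \<Longrightarrow> (\<ll> A \<otimes>\<^sub>a \<ll> B) \<cdot> \<kappa> (T\<^sub>o A) (T\<^sub>o B) \<cdot> T\<^sub>a (\<kappa> A B) = \<kappa> A B \<cdot> \<ll> (A \<otimes> B)"
    and strength_flip: "\<lbrakk>A \<in> Obj C; B \<in> Obj C\<rbrakk>
      \<Longrightarrow> (\<cc> A \<otimes>\<^sub>a \<cc> B) \<cdot> \<kappa> (T\<^sub>o A) (T\<^sub>o B) \<cdot> T\<^sub>a (\<kappa> A B)
        = \<kappa> (T\<^sub>o A) (T\<^sub>o B) \<cdot> T\<^sub>a (\<kappa> A B) \<cdot> \<cc> (A \<otimes> B)"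

text \<open>
  The canonical isomorphisms between \<open>(A \<times> B) \<times> (D \<times> E)\<close> and \<open>(A \<times> (B \<times> D)) \<times> E\<close>.
\<close>

definition regroup_middle ::
    "('o, 'a, 'm) cartesian_tangent_data_scheme \<Rightarrow> 'o \<Rightarrow> 'o \<Rightarrow> 'o \<Rightarrow> 'o \<Rightarrow> 'a"
  where "regroup_middle C A B D E =
    (let l = \<pi>\<^sub>0 (A \<otimes> B) (D \<otimes> E); r = \<pi>\<^sub>1 (A \<otimes> B) (D \<otimes> E) in
      \<langle>\<langle>l \<cdot> \<pi>\<^sub>0 A B, \<langle>l \<cdot> \<pi>\<^sub>1 A B, r \<cdot> \<pi>\<^sub>0 D E\<rangle>\<rangle>, r \<cdot> \<pi>\<^sub>1 D E\<rangle>)"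
  for C (structure)

definition regroup_pairs ::
    "('o, 'a, 'm) cartesian_tangent_data_scheme \<Rightarrow> 'o \<Rightarrow> 'o \<Rightarrow> 'o \<Rightarrow> 'o \<Rightarrow> 'a"
  where "regroup_pairs C A B D E =
    (let l = \<pi>\<^sub>0 (A \<otimes> (B \<otimes> D)) E; r = \<pi>\<^sub>1 (A \<otimes> (B \<otimes> D)) E;
         a = l \<cdot> \<pi>\<^sub>0 A (B \<otimes> D);
         b = l \<cdot> \<pi>\<^sub>1 A (B \<otimes> D) \<cdot> \<pi>\<^sub>0 B D;
         d = l \<cdot> \<pi>\<^sub>1 A (B \<otimes> D) \<cdot> \<pi>\<^sub>1 B D in
      \<langle>\<langle>a, b\<rangle>, \<langle>d, r\<rangle>\<rangle>)"
  for C (structure)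


section \<open>Group objects\<close>

definition group_object ::
    "('o, 'a, 'm) cartesian_tangent_data_scheme \<Rightarrow> 'o \<Rightarrow> 'a \<Rightarrow> 'a \<Rightarrow> 'a \<Rightarrow> bool"
  where "group_object C G m u \<iota> \<longleftrightarrow>
    G \<in> Obj C \<and> m \<in> hom C (G \<otimes> G) G \<and> u \<in> hom C \<one> G \<and> \<iota> \<in> hom C G G \<and>
    (let l = \<pi>\<^sub>0 (G \<otimes> G) G; r = \<pi>\<^sub>1 (G \<otimes> G) G;
         assoc = \<langle>l \<cdot> \<pi>\<^sub>0 G G, \<langle>l \<cdot> \<pi>\<^sub>1 G G, r\<rangle>\<rangle> in
      (m \<otimes>\<^sub>a \<id> G) \<cdot> m = assoc \<cdot> (\<id> G \<otimes>\<^sub>a m) \<cdot> m) \<and>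
    \<langle>to_one C G \<cdot> u, \<id> G\<rangle> \<cdot> m = \<id> G \<and> \<langle>\<id> G, to_one C G \<cdot> u\<rangle> \<cdot> m = \<id> G \<and>
    \<langle>\<iota>, \<id> G\<rangle> \<cdot> m = to_one C G \<cdot> u \<and> \<langle>\<id> G, \<iota>\<rangle> \<cdot> m = to_one C G \<cdot> u"
  for C (structure)

text \<open>
  \<open>T(m) : T(G) \<times> T(G) \<rightarrow> T(G)\<close>, and \<open>T(m\<^sub>3)\<close> on \<open>(T(G) \<times> T(G)) \<times> T(G)\<close>.
\<close>

definition Tmult :: "('o, 'a, 'm) cartesian_tangent_data_scheme \<Rightarrow> 'o \<Rightarrow> 'a \<Rightarrow> 'a"
  where "Tmult C G m = \<kappa> G G \<cdot> T\<^sub>a m"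
  for C (structure)

definition mult3 :: "('o, 'a, 'm) cartesian_tangent_data_scheme \<Rightarrow> 'o \<Rightarrow> 'a \<Rightarrow> 'a"
  where "mult3 C G m = (m \<otimes>\<^sub>a \<id> G) \<cdot> m"
  for C (structure)

definition Tmult3 :: "('o, 'a, 'm) cartesian_tangent_data_scheme \<Rightarrow> 'o \<Rightarrow> 'a \<Rightarrow> 'a"
  where "Tmult3 C G m = (\<kappa> G G \<otimes>\<^sub>a \<id> (T\<^sub>o G)) \<cdot> \<kappa> (G \<otimes> G) G \<cdot> T\<^sub>a (mult3 C G m)"
  for C (structure)

text \<open>
  Below, \<open>q : H \<rightarrow> T(G)\<close> is the projection \<open>p\<^sub>u\<^sup>*\<close> of the pullback \<open>H = T(G)\<^sub>u\<close>. The other projection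
  goes to the terminal object, so a map \<open>\<langle>!, h\<rangle>\<close> into \<open>H\<close> is \<open>factor C q h\<close>.
\<close>

definition fibre_at_unit ::
    "('o, 'a, 'm) cartesian_tangent_data_scheme \<Rightarrow> 'o \<Rightarrow> 'a \<Rightarrow> 'o \<Rightarrow> 'a \<Rightarrow> bool"
  where "fibre_at_unit C G u H q \<longleftrightarrow> is_pullback C u (\<pp> G) H (to_one C H) q"
  for C (structure)

definition Tmult_u :: "('o, 'a, 'm) cartesian_tangent_data_scheme \<Rightarrow> 'o \<Rightarrow> 'a \<Rightarrow> 'a \<Rightarrow> 'a"
  where "Tmult_u C G m q = factor C q ((q \<otimes>\<^sub>a q) \<cdot> Tmult C G m)"
  for C (structure)

definition Ad_r ::
    "('o, 'a, 'm) cartesian_tangent_data_scheme \<Rightarrow> 'o \<Rightarrow> 'a \<Rightarrow> 'a \<Rightarrow> 'o \<Rightarrow> 'a \<Rightarrow> 'a"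
  where "Ad_r C G m \<iota> H q =
    factor C q
      (\<langle>\<langle>\<pi>\<^sub>1 H G \<cdot> \<iota> \<cdot> \<zero> G, \<pi>\<^sub>0 H G \<cdot> q\<rangle>, \<pi>\<^sub>1 H G \<cdot> \<zero> G\<rangle> \<cdot> Tmult3 C G m)"
  for C (structure)

definition phi_inv :: "('o, 'a, 'm) cartesian_tangent_data_scheme \<Rightarrow> 'o \<Rightarrow> 'a \<Rightarrow> 'a \<Rightarrow> 'a"
  where "phi_inv C G m q = (\<zero> G \<otimes>\<^sub>a q) \<cdot> Tmult C G m"
  for C (structure)

definition swap_Ad ::
    "('o, 'a, 'm) cartesian_tangent_data_scheme \<Rightarrow> 'o \<Rightarrow> 'a \<Rightarrow> 'a \<Rightarrow> 'o \<Rightarrow> 'a \<Rightarrow> 'a"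
  where "swap_Ad C G m \<iota> H q = \<langle>\<pi>\<^sub>1 H G, Ad_r C G m \<iota> H q\<rangle>"
  for C (structure)

end

theory Submission
  imports Defs
begin

text \<open>
  The claim is the usual computation behind a semidirect product. For each object \<open>Z\<close> the maps
  \<open>Z \<rightarrow> T(G)\<close> carry the multiplication \<open>a \<star> b = \<langle>a, b\<rangle> T(m)\<close>, and \<open>\<phi>\<inverse>\<close> sends a pair \<open>(g, k)\<close> to
  \<open>g0 \<star> k\<close>, where \<open>k\<close> is identified with its image in \<open>T(G)\<close>. Since
  \<open>g'0 \<star> Ad\<^sub>r(k, g') = g'0 \<star> (g'\<inverse>0 \<star> k \<star> g'0) = k \<star> g'0\<close>,
  \<open>(g0 \<star> k) \<star> (g'0 \<star> k') = (g0 \<star> g'0) \<star> (Ad\<^sub>r(k, g') \<star> k') = (gg')0 \<star> (Ad\<^sub>r(k, g') \<star> k')\<close>,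
  which is the value of the right-hand side at \<open>((g, k), (g', k'))\<close>. Taking these to be the projections
  of \<open>(G \<times> H) \<times> (G \<times> H)\<close>, with \<open>H = T(G)\<^sub>u\<close>, gives the equation of arrows.

  The computation needs associativity of \<open>\<star>\<close> (\<open>Tmult_el_assoc\<close>), the zero vector at \<open>u\<close> as left unit
  (\<open>Tmult_el_unit_left\<close>) and that the zero section preserves products (\<open>zero_mult_el\<close>), hence inverses.
  The first two are \<open>T\<close> applied to laws of \<open>m\<close>; the third holds since \<open>0\<close> is natural and respects
  finite products. Moreover \<open>p\<close> preserves
  products (\<open>tproj_Tmult_el\<close>), so products and conjugates of vectors over \<open>u\<close> are again over \<open>u\<close>, and
  the arrows \<open>T(m)\<^sub>u\<close> and \<open>Ad\<^sub>r\<close> into the pullback exist. An arrow into \<open>H\<close> enters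
  the computation only through its composite with \<open>q : H \<rightarrow> T(G)\<close>.
\<close>

section \<open>Products and the tangent functor on generalized elements\<close>

lemma (in category) hom_objs:
  assumes "f \<in> hom C A B"
  shows "A \<in> Obj C" "B \<in> Obj C"
  using assms dom_obj cod_obj by (auto simp: hom_def)

lemma (in category) inverse_of_inverse_arrows:
  assumes "iso C f"
  shows "inverse_arrows C f (inverse_of C f)"
proof -
  obtain g where g: "inverse_arrows C f g"
    using assms by (auto simp: iso_def)
  have "g' = g" if g': "inverse_arrows C f g'" for g'
  proof -
    have f: "f \<in> hom C (Dom C f) (Cod C f)"
      and gh: "g \<in> hom C (Cod C f) (Dom C f)" "g' \<in> hom C (Cod C f) (Dom C f)"
      using g g' by (auto simp: inverse_arrows_def hom_def)
    have "g' = g' \<cdot> (f \<cdot> g)"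
      using g comp_id[OF gh(2)] by (simp add: inverse_arrows_def)
    also have "\<dots> = (g' \<cdot> f) \<cdot> g"
      using comp_assoc[OF gh(2) f gh(1)] by simp
    also have "\<dots> = g"
      using g' id_comp[OF gh(1)] by (simp add: inverse_arrows_def)
    finally show ?thesis .
  qed
  then show ?thesis
    unfolding inverse_of_def using g by (metis theI)
qed

context cartesian_tangent_category
begin

lemma Pr_hom:
  assumes "A \<in> Obj C" "B \<in> Obj C"
  shows "\<pi>\<^sub>0 A B \<in> hom C (A \<otimes> B) A" "\<pi>\<^sub>1 A B \<in> hom C (A \<otimes> B) B" "A \<otimes> B \<in> Obj C"
  using products[OF assms] by (auto simp: is_product_def)

lemma pair_laws:
  assumes "f \<in> hom C Z A" "g \<in> hom C Z B"
  shows pair_hom: "\<langle>f, g\<rangle> \<in> hom C Z (A \<otimes> B)"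
    and pair_Pr0: "\<langle>f, g\<rangle> \<cdot> \<pi>\<^sub>0 A B = f"
    and pair_Pr1: "\<langle>f, g\<rangle> \<cdot> \<pi>\<^sub>1 A B = g"
proof -
  have "\<exists>!h. h \<in> hom C Z (A \<otimes> B) \<and> h \<cdot> \<pi>\<^sub>0 A B = f \<and> h \<cdot> \<pi>\<^sub>1 A B = g"
    using products[of A B] assms hom_objs[OF assms(1)] hom_objs[OF assms(2)]
    by (simp add: is_product_def)
  from theI'[OF this] assms
  show "\<langle>f, g\<rangle> \<in> hom C Z (A \<otimes> B)" "\<langle>f, g\<rangle> \<cdot> \<pi>\<^sub>0 A B = f" "\<langle>f, g\<rangle> \<cdot> \<pi>\<^sub>1 A B = g"
    by (auto simp: pair_def tuple_def hom_def Let_def)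
qed

lemma pair_eqI:
  assumes "h \<in> hom C Z (A \<otimes> B)" "A \<in> Obj C" "B \<in> Obj C"
    and "h \<cdot> \<pi>\<^sub>0 A B = f" "h \<cdot> \<pi>\<^sub>1 A B = g"
  shows "h = \<langle>f, g\<rangle>"
proof -
  have fg: "f \<in> hom C Z A" "g \<in> hom C Z B"
    using assms comp_hom Pr_hom by metis+
  then have "\<exists>!h. h \<in> hom C Z (A \<otimes> B) \<and> h \<cdot> \<pi>\<^sub>0 A B = f \<and> h \<cdot> \<pi>\<^sub>1 A B = g"
    using products[of A B] assms(2,3) by (simp add: is_product_def)
  then show ?thesis
    using assms pair_laws[OF fg] by blast
qed

lemma comp_pair:
  assumes h: "h \<in> hom C Z Y" and f: "f \<in> hom C Y A" and g: "g \<in> hom C Y B"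
  shows "h \<cdot> \<langle>f, g\<rangle> = \<langle>h \<cdot> f, h \<cdot> g\<rangle>"
proof (rule pair_eqI)
  note A = hom_objs(2)[OF f] hom_objs(2)[OF g]
  show "A \<in> Obj C" "B \<in> Obj C" by fact+
  show "h \<cdot> \<langle>f, g\<rangle> \<in> hom C Z (A \<otimes> B)"
    by (rule comp_hom[OF h pair_hom[OF f g]])
  show "h \<cdot> \<langle>f, g\<rangle> \<cdot> \<pi>\<^sub>0 A B = h \<cdot> f" "h \<cdot> \<langle>f, g\<rangle> \<cdot> \<pi>\<^sub>1 A B = h \<cdot> g"
    using comp_assoc[OF h pair_hom[OF f g]] Pr_hom[OF A] pair_laws[OF f g] by auto
qed

lemma prod_arr_pair:
  assumes f: "f \<in> hom C A A'" and g: "g \<in> hom C B B'"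
  shows "f \<otimes>\<^sub>a g = \<langle>\<pi>\<^sub>0 A B \<cdot> f, \<pi>\<^sub>1 A B \<cdot> g\<rangle>"
  using f g by (auto simp: prod_arr_def hom_def Let_def)

lemma prod_arr_hom:
  assumes f: "f \<in> hom C A A'" and g: "g \<in> hom C B B'"
  shows "f \<otimes>\<^sub>a g \<in> hom C (A \<otimes> B) (A' \<otimes> B')"
proof -
  note P = Pr_hom[OF hom_objs(1)[OF f] hom_objs(1)[OF g]]
  show ?thesis
    unfolding prod_arr_pair[OF f g]
    by (rule pair_hom[OF comp_hom[OF P(1) f] comp_hom[OF P(2) g]])
qed

lemma pair_prod_arr:
  assumes x: "x \<in> hom C Z A" and y: "y \<in> hom C Z B"
    and f: "f \<in> hom C A A'" and g: "g \<in> hom C B B'"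
  shows "\<langle>x, y\<rangle> \<cdot> (f \<otimes>\<^sub>a g) = \<langle>x \<cdot> f, y \<cdot> g\<rangle>"
proof -
  note P = Pr_hom[OF hom_objs(1)[OF f] hom_objs(1)[OF g]] and xy = pair_hom[OF x y]
  have "\<langle>x, y\<rangle> \<cdot> (f \<otimes>\<^sub>a g) = \<langle>\<langle>x, y\<rangle> \<cdot> (\<pi>\<^sub>0 A B \<cdot> f), \<langle>x, y\<rangle> \<cdot> (\<pi>\<^sub>1 A B \<cdot> g)\<rangle>"
    using comp_pair[OF xy comp_hom[OF P(1) f] comp_hom[OF P(2) g]] prod_arr_pair[OF f g] by simp
  also have "\<langle>x, y\<rangle> \<cdot> (\<pi>\<^sub>0 A B \<cdot> f) = x \<cdot> f"
    using comp_assoc[OF xy P(1) f] pair_Pr0[OF x y] by simp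
  also have "\<langle>x, y\<rangle> \<cdot> (\<pi>\<^sub>1 A B \<cdot> g) = y \<cdot> g"
    using comp_assoc[OF xy P(2) g] pair_Pr1[OF x y] by simp
  finally show ?thesis .
qed

lemma pair_regroup_pairs:
  assumes a: "a \<in> hom C Z A" and b: "b \<in> hom C Z B" and d: "d \<in> hom C Z D" and e: "e \<in> hom C Z E"
  shows "\<langle>\<langle>a, \<langle>b, d\<rangle>\<rangle>, e\<rangle> \<cdot> regroup_pairs C A B D E = \<langle>\<langle>a, b\<rangle>, \<langle>d, e\<rangle>\<rangle>"
proof -
  note O = hom_objs(2)[OF a] hom_objs(2)[OF b] hom_objs(2)[OF d] hom_objs(2)[OF e]
  note bd = pair_hom[OF b d]
  note abd = pair_hom[OF a bd]
  note t = pair_hom[OF abd e]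
  note BD = Pr_hom[OF O(2,3)]
  note ABD = Pr_hom[OF O(1) BD(3)]
  note L = Pr_hom[OF ABD(3) O(4)]
  note l0 = comp_hom[OF L(1) ABD(1)] and l1 = comp_hom[OF L(1) ABD(2)]
  note l10 = comp_hom[OF l1 BD(1)] and l11 = comp_hom[OF l1 BD(2)]
  show ?thesis
    unfolding regroup_pairs_def Let_def
    using comp_pair[OF t pair_hom[OF l0 l10] pair_hom[OF l11 L(2)]] comp_pair[OF t l0 l10]
      comp_pair[OF t l11 L(2)] comp_assoc[OF t L(1) ABD(1)] comp_assoc[OF t L(1) ABD(2)]
      comp_assoc[OF t l1 BD(1)] comp_assoc[OF t l1 BD(2)]
      pair_laws[OF abd e] pair_laws[OF a bd] pair_laws[OF b d]
    by simp
qed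

lemma one_obj: "\<one> \<in> Obj C"
  using terminal by (simp add: is_terminal_def)

lemma to_one_hom: "A \<in> Obj C \<Longrightarrow> to_one C A \<in> hom C A \<one>"
  unfolding to_one_def using terminal theI' by (metis is_terminal_def)

lemma hom_one_unique:
  assumes "f \<in> hom C A \<one>" "g \<in> hom C A \<one>"
  shows "f = g"
  using terminal assms hom_objs(1)[OF assms(1)] by (auto simp: is_terminal_def)

lemma T_laws:
  shows T_obj: "A \<in> Obj C \<Longrightarrow> T\<^sub>o A \<in> Obj C"
    and T_id: "A \<in> Obj C \<Longrightarrow> T\<^sub>a (\<id> A) = \<id> (T\<^sub>o A)"
    and T_hom: "f \<in> hom C A B \<Longrightarrow> T\<^sub>a f \<in> hom C (T\<^sub>o A) (T\<^sub>o B)"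
    and T_comp: "\<lbrakk>f \<in> hom C A B; g \<in> hom C B D\<rbrakk> \<Longrightarrow> T\<^sub>a (f \<cdot> g) = T\<^sub>a f \<cdot> T\<^sub>a g"
  using T_functor unfolding is_functor_def by blast+

lemma zero_laws:
  shows zero_hom: "A \<in> Obj C \<Longrightarrow> \<zero> A \<in> hom C A (T\<^sub>o A)"
    and zero_nat: "f \<in> hom C A B \<Longrightarrow> f \<cdot> \<zero> B = \<zero> A \<cdot> T\<^sub>a f"
  using zero_natural unfolding is_nat_trans_def by blast+

lemma tproj_laws:
  shows tproj_hom: "A \<in> Obj C \<Longrightarrow> \<pp> A \<in> hom C (T\<^sub>o A) A"
    and tproj_nat: "f \<in> hom C A B \<Longrightarrow> T\<^sub>a f \<cdot> \<pp> B = \<pp> A \<cdot> f"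
  using p_natural unfolding is_nat_trans_def by blast+

lemma zero_tproj: "A \<in> Obj C \<Longrightarrow> \<zero> A \<cdot> \<pp> A = \<id> A"
  using additive[of A] tproj_hom[of A] by (simp add: additive_bundle_def Let_def hom_def)

text \<open>
  \<open>T(1)\<close> is isomorphic to \<open>1\<close>, so it is terminal.
\<close>

lemma hom_T_one_unique:
  assumes f: "f \<in> hom C A (T\<^sub>o \<one>)" and g: "g \<in> hom C A (T\<^sub>o \<one>)"
  shows "f = g"
proof -
  define t where "t = to_one C (T\<^sub>o \<one>)"
  define t' where "t' = inverse_of C t"
  have t: "t \<in> hom C (T\<^sub>o \<one>) \<one>"
    unfolding t_def by (rule to_one_hom[OF T_obj[OF one_obj]])
  have inv: "inverse_arrows C t t'"
    unfolding t_def t'_def by (rule inverse_of_inverse_arrows[OF T_terminal])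
  have t': "t' \<in> hom C \<one> (T\<^sub>o \<one>)" and tt': "t \<cdot> t' = \<id> (T\<^sub>o \<one>)"
    using inv t by (auto simp: inverse_arrows_def hom_def)
  have "h = h \<cdot> t \<cdot> t'" if "h \<in> hom C A (T\<^sub>o \<one>)" for h
    using comp_assoc[OF that t t'] tt' comp_id[OF that] by simp
  then show ?thesis
    using hom_one_unique[OF comp_hom[OF f t] comp_hom[OF g t]] f g by metis
qed

lemma strength_laws:
  assumes A: "A \<in> Obj C" and B: "B \<in> Obj C"
  shows strength_hom: "\<kappa> A B \<in> hom C (T\<^sub>o A \<otimes> T\<^sub>o B) (T\<^sub>o (A \<otimes> B))"
    and strength_comparison: "\<kappa> A B \<cdot> comparison C A B = \<id> (T\<^sub>o A \<otimes> T\<^sub>o B)"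
    and comparison_strength: "comparison C A B \<cdot> \<kappa> A B = \<id> (T\<^sub>o (A \<otimes> B))"
proof -
  have "comparison C A B \<in> hom C (T\<^sub>o (A \<otimes> B)) (T\<^sub>o A \<otimes> T\<^sub>o B)"
    unfolding comparison_def by (intro pair_hom T_hom Pr_hom A B)
  then show "\<kappa> A B \<in> hom C (T\<^sub>o A \<otimes> T\<^sub>o B) (T\<^sub>o (A \<otimes> B))"
    "\<kappa> A B \<cdot> comparison C A B = \<id> (T\<^sub>o A \<otimes> T\<^sub>o B)"
    "comparison C A B \<cdot> \<kappa> A B = \<id> (T\<^sub>o (A \<otimes> B))"
    using inverse_of_inverse_arrows[OF T_products[OF A B]]
    by (auto simp: strength_def inverse_arrows_def hom_def)
qed

text \<open>
  Suppressing \<open>\<kappa>\<close> means reading \<open>\<langle>a, b\<rangle> \<cdot> \<kappa> A B\<close> as the pair of \<open>a\<close> and \<open>b\<close> in \<open>T(A \<times> B)\<close>. This and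
  the next two lemmas say that it has the projections, the uniqueness and the behaviour under
  \<open>T\<langle>f, g\<rangle>\<close> expected of a pair.
\<close>

lemma Tpair_laws:
  assumes a: "a \<in> hom C Z (T\<^sub>o A)" and b: "b \<in> hom C Z (T\<^sub>o B)"
    and A: "A \<in> Obj C" and B: "B \<in> Obj C"
  shows Tpair_hom: "\<langle>a, b\<rangle> \<cdot> \<kappa> A B \<in> hom C Z (T\<^sub>o (A \<otimes> B))"
    and Tpair_Pr0: "\<langle>a, b\<rangle> \<cdot> \<kappa> A B \<cdot> T\<^sub>a (\<pi>\<^sub>0 A B) = a"
    and Tpair_Pr1: "\<langle>a, b\<rangle> \<cdot> \<kappa> A B \<cdot> T\<^sub>a (\<pi>\<^sub>1 A B) = b"
proof -
  note k = strength_hom[OF A B] and ab = pair_hom[OF a b]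
  note T0 = T_hom[OF Pr_hom(1)[OF A B]] and T1 = T_hom[OF Pr_hom(2)[OF A B]]
  note c = pair_hom[OF T0 T1]
  show h: "\<langle>a, b\<rangle> \<cdot> \<kappa> A B \<in> hom C Z (T\<^sub>o (A \<otimes> B))"
    by (rule comp_hom[OF ab k])
  have "\<langle>a, b\<rangle> = \<langle>a, b\<rangle> \<cdot> (\<kappa> A B \<cdot> comparison C A B)"
    using comp_id[OF ab] strength_comparison[OF A B] by simp
  also have "\<dots> = \<langle>\<langle>a, b\<rangle> \<cdot> \<kappa> A B \<cdot> T\<^sub>a (\<pi>\<^sub>0 A B), \<langle>a, b\<rangle> \<cdot> \<kappa> A B \<cdot> T\<^sub>a (\<pi>\<^sub>1 A B)\<rangle>"
    using comp_assoc[OF ab k c] comp_pair[OF h T0 T1] by (simp add: comparison_def)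
  finally have eq: "\<langle>a, b\<rangle> =
      \<langle>\<langle>a, b\<rangle> \<cdot> \<kappa> A B \<cdot> T\<^sub>a (\<pi>\<^sub>0 A B), \<langle>a, b\<rangle> \<cdot> \<kappa> A B \<cdot> T\<^sub>a (\<pi>\<^sub>1 A B)\<rangle>" .
  show "\<langle>a, b\<rangle> \<cdot> \<kappa> A B \<cdot> T\<^sub>a (\<pi>\<^sub>0 A B) = a"
    using pair_Pr0[OF a b] pair_Pr0[OF comp_hom[OF h T0] comp_hom[OF h T1]] eq by metis
  show "\<langle>a, b\<rangle> \<cdot> \<kappa> A B \<cdot> T\<^sub>a (\<pi>\<^sub>1 A B) = b"
    using pair_Pr1[OF a b] pair_Pr1[OF comp_hom[OF h T0] comp_hom[OF h T1]] eq by metis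
qed

lemma Tpair_eqI:
  assumes h: "h \<in> hom C Z (T\<^sub>o (A \<otimes> B))" and A: "A \<in> Obj C" and B: "B \<in> Obj C"
    and "h \<cdot> T\<^sub>a (\<pi>\<^sub>0 A B) = a" "h \<cdot> T\<^sub>a (\<pi>\<^sub>1 A B) = b"
  shows "h = \<langle>a, b\<rangle> \<cdot> \<kappa> A B"
proof -
  note T0 = T_hom[OF Pr_hom(1)[OF A B]] and T1 = T_hom[OF Pr_hom(2)[OF A B]]
  have "h = h \<cdot> (comparison C A B \<cdot> \<kappa> A B)"
    using comp_id[OF h] comparison_strength[OF A B] by simp
  also have "\<dots> = h \<cdot> comparison C A B \<cdot> \<kappa> A B"
    using comp_assoc[OF h pair_hom[OF T0 T1] strength_hom[OF A B]] by (simp add: comparison_def)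
  also have "h \<cdot> comparison C A B = \<langle>a, b\<rangle>"
    using comp_pair[OF h T0 T1] assms(4,5) by (simp add: comparison_def)
  finally show ?thesis .
qed

lemma comp_T_pair:
  assumes h: "h \<in> hom C Z (T\<^sub>o Y)" and f: "f \<in> hom C Y A" and g: "g \<in> hom C Y B"
  shows "h \<cdot> T\<^sub>a \<langle>f, g\<rangle> = \<langle>h \<cdot> T\<^sub>a f, h \<cdot> T\<^sub>a g\<rangle> \<cdot> \<kappa> A B"
proof (rule Tpair_eqI)
  note AB = hom_objs(2)[OF f] hom_objs(2)[OF g]
  note fg = pair_hom[OF f g] and P = Pr_hom[OF AB]
  show "A \<in> Obj C" "B \<in> Obj C" by fact+
  show "h \<cdot> T\<^sub>a \<langle>f, g\<rangle> \<in> hom C Z (T\<^sub>o (A \<otimes> B))"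
    by (rule comp_hom[OF h T_hom[OF fg]])
  show "h \<cdot> T\<^sub>a \<langle>f, g\<rangle> \<cdot> T\<^sub>a (\<pi>\<^sub>0 A B) = h \<cdot> T\<^sub>a f"
    using comp_assoc[OF h T_hom[OF fg] T_hom[OF P(1)]] T_comp[OF fg P(1)] pair_Pr0[OF f g] by simp
  show "h \<cdot> T\<^sub>a \<langle>f, g\<rangle> \<cdot> T\<^sub>a (\<pi>\<^sub>1 A B) = h \<cdot> T\<^sub>a g"
    using comp_assoc[OF h T_hom[OF fg] T_hom[OF P(2)]] T_comp[OF fg P(2)] pair_Pr1[OF f g] by simp
qed

end


section \<open>The tangent group on generalized elements\<close>

locale tangent_group = cartesian_tangent_category C
  for C :: "('o, 'a, 'm) cartesian_tangent_data_scheme" (structure) +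
  fixes G :: 'o and m u \<iota> :: 'a
  assumes group: "group_object C G m u \<iota>"
begin

abbreviation mult_el :: "'a \<Rightarrow> 'a \<Rightarrow> 'a"  (infixl "\<bullet>" 65)
  where "x \<bullet> y \<equiv> \<langle>x, y\<rangle> \<cdot> m"

abbreviation Tmult_el :: "'a \<Rightarrow> 'a \<Rightarrow> 'a"  (infixl "\<star>" 65)
  where "a \<star> b \<equiv> \<langle>a, b\<rangle> \<cdot> Tmult C G m"

abbreviation unit_el :: "'o \<Rightarrow> 'a"  ("\<e>")
  where "\<e> Z \<equiv> to_one C Z \<cdot> u"

lemma group_homs:
  shows G_obj: "G \<in> Obj C" and m_hom: "m \<in> hom C (G \<otimes> G) G"
    and u_hom: "u \<in> hom C \<one> G" and inv_hom: "\<iota> \<in> hom C G G"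
  using group by (auto simp: group_object_def)

lemma Tmult_hom: "Tmult C G m \<in> hom C (T\<^sub>o G \<otimes> T\<^sub>o G) (T\<^sub>o G)"
  unfolding Tmult_def by (rule comp_hom[OF strength_hom[OF G_obj G_obj] T_hom[OF m_hom]])

lemma mult_el_hom: "\<lbrakk>x \<in> hom C Z G; y \<in> hom C Z G\<rbrakk> \<Longrightarrow> x \<bullet> y \<in> hom C Z G"
  by (rule comp_hom[OF pair_hom m_hom])

lemma Tmult_el_hom: "\<lbrakk>a \<in> hom C Z (T\<^sub>o G); b \<in> hom C Z (T\<^sub>o G)\<rbrakk> \<Longrightarrow> a \<star> b \<in> hom C Z (T\<^sub>o G)"
  by (rule comp_hom[OF pair_hom Tmult_hom])

lemma unit_el_hom: "Z \<in> Obj C \<Longrightarrow> \<e> Z \<in> hom C Z G"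
  by (rule comp_hom[OF to_one_hom u_hom])

lemma comp_unit_el:
  assumes x: "x \<in> hom C Z Y"
  shows "x \<cdot> \<e> Y = \<e> Z"
proof -
  note YZ = hom_objs[OF x]
  have "x \<cdot> to_one C Y = to_one C Z"
    by (rule hom_one_unique[OF comp_hom[OF x to_one_hom] to_one_hom]) fact+
  then show ?thesis
    using comp_assoc[OF x to_one_hom[OF YZ(2)] u_hom] by simp
qed

lemma comp_Tmult_el:
  assumes h: "h \<in> hom C Z Y" and a: "a \<in> hom C Y (T\<^sub>o G)" and b: "b \<in> hom C Y (T\<^sub>o G)"
  shows "h \<cdot> (a \<star> b) = (h \<cdot> a) \<star> (h \<cdot> b)"
  using comp_assoc[OF h pair_hom[OF a b] Tmult_hom] comp_pair[OF h a b] by simp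

lemma mult_el_unit:
  assumes x: "x \<in> hom C Z G"
  shows "x \<bullet> \<e> Z = x"
proof -
  note i = id_hom[OF G_obj] and e = unit_el_hom[OF G_obj]
  have "x \<bullet> \<e> Z = \<langle>x \<cdot> \<id> G, x \<cdot> \<e> G\<rangle> \<cdot> m"
    by (simp add: comp_id[OF x] comp_unit_el[OF x])
  also have "\<dots> = x \<cdot> (\<langle>\<id> G, \<e> G\<rangle> \<cdot> m)"
    using comp_assoc[OF x pair_hom[OF i e] m_hom] comp_pair[OF x i e] by simp
  also have "\<dots> = x"
    using group comp_id[OF x] by (simp add: group_object_def)
  finally show ?thesis .
qed

lemma mult_el_inverse:
  assumes x: "x \<in> hom C Z G"
  shows mult_el_inv_left: "(x \<cdot> \<iota>) \<bullet> x = \<e> Z" and mult_el_inv_right: "x \<bullet> (x \<cdot> \<iota>) = \<e> Z"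
proof -
  note i = id_hom[OF G_obj]
  have "(x \<cdot> \<iota>) \<bullet> x = x \<cdot> (\<langle>\<iota>, \<id> G\<rangle> \<cdot> m)"
    using comp_assoc[OF x pair_hom[OF inv_hom i] m_hom] comp_pair[OF x inv_hom i] comp_id[OF x]
    by simp
  then show "(x \<cdot> \<iota>) \<bullet> x = \<e> Z"
    using group comp_unit_el[OF x] by (simp add: group_object_def)
  have "x \<bullet> (x \<cdot> \<iota>) = x \<cdot> (\<langle>\<id> G, \<iota>\<rangle> \<cdot> m)"
    using comp_assoc[OF x pair_hom[OF i inv_hom] m_hom] comp_pair[OF x i inv_hom] comp_id[OF x]
    by simp
  then show "x \<bullet> (x \<cdot> \<iota>) = \<e> Z"
    using group comp_unit_el[OF x] by (simp add: group_object_def)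
qed

lemma Tmult_el_eq:
  assumes a: "a \<in> hom C Z (T\<^sub>o G)" and b: "b \<in> hom C Z (T\<^sub>o G)"
  shows "a \<star> b = \<langle>a, b\<rangle> \<cdot> \<kappa> G G \<cdot> T\<^sub>a m"
  unfolding Tmult_def
  by (rule comp_assoc[OF pair_hom[OF a b] strength_hom[OF G_obj G_obj] T_hom[OF m_hom], symmetric])

text \<open>
  Both bracketings of \<open>a \<star> b \<star> c\<close> are images of one triple \<open>t\<close> in \<open>T((G \<times> G) \<times> G)\<close>, so associativity
  of \<open>T(m)\<close> is \<open>T\<close> applied to associativity of \<open>m\<close>. The first half also evaluates \<open>T(m\<^sub>3)\<close>.
\<close>

lemma T_mult3_triple:
  assumes a: "a \<in> hom C Z (T\<^sub>o G)" and b: "b \<in> hom C Z (T\<^sub>o G)" and c: "c \<in> hom C Z (T\<^sub>o G)"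
  shows "\<langle>\<langle>a, b\<rangle> \<cdot> \<kappa> G G, c\<rangle> \<cdot> \<kappa> (G \<otimes> G) G \<cdot> T\<^sub>a (mult3 C G m) = (a \<star> b) \<star> c"
    and "\<langle>\<langle>a, b\<rangle> \<cdot> \<kappa> G G, c\<rangle> \<cdot> \<kappa> (G \<otimes> G) G \<cdot> T\<^sub>a (mult3 C G m) = a \<star> (b \<star> c)"
proof -
  note G = G_obj and i = id_hom[OF G_obj]
  note GG = Pr_hom(3)[OF G G]
  note P = Pr_hom[OF G G] and Q = Pr_hom[OF GG G]
  note ab = Tpair_hom[OF a b G G]
  define t where "t = \<langle>\<langle>a, b\<rangle> \<cdot> \<kappa> G G, c\<rangle> \<cdot> \<kappa> (G \<otimes> G) G"
  have t: "t \<in> hom C Z (T\<^sub>o ((G \<otimes> G) \<otimes> G))"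
    and t0: "t \<cdot> T\<^sub>a (\<pi>\<^sub>0 (G \<otimes> G) G) = \<langle>a, b\<rangle> \<cdot> \<kappa> G G" and t1: "t \<cdot> T\<^sub>a (\<pi>\<^sub>1 (G \<otimes> G) G) = c"
    unfolding t_def using Tpair_laws[OF ab c GG G] by simp_all
  have t0_comp: "t \<cdot> T\<^sub>a (\<pi>\<^sub>0 (G \<otimes> G) G \<cdot> f) = \<langle>a, b\<rangle> \<cdot> \<kappa> G G \<cdot> T\<^sub>a f"
    if f: "f \<in> hom C (G \<otimes> G) A" for f A
    using T_comp[OF Q(1) f] comp_assoc[OF t T_hom[OF Q(1)] T_hom[OF f]] t0 by simp
  have m1: "m \<otimes>\<^sub>a \<id> G = \<langle>\<pi>\<^sub>0 (G \<otimes> G) G \<cdot> m, \<pi>\<^sub>1 (G \<otimes> G) G\<rangle>"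
    using prod_arr_pair[OF m_hom i] comp_id[OF Q(2)] by simp
  have "t \<cdot> T\<^sub>a (mult3 C G m) = t \<cdot> T\<^sub>a (m \<otimes>\<^sub>a \<id> G) \<cdot> T\<^sub>a m"
    using T_comp[OF prod_arr_hom[OF m_hom i] m_hom]
      comp_assoc[OF t T_hom[OF prod_arr_hom[OF m_hom i]] T_hom[OF m_hom]]
    by (simp add: mult3_def)
  also have "t \<cdot> T\<^sub>a (m \<otimes>\<^sub>a \<id> G) = \<langle>a \<star> b, c\<rangle> \<cdot> \<kappa> G G"
    using comp_T_pair[OF t comp_hom[OF Q(1) m_hom] Q(2)] t0_comp[OF m_hom] t1 Tmult_el_eq[OF a b]
    by (simp add: m1)
  finally show "\<langle>\<langle>a, b\<rangle> \<cdot> \<kappa> G G, c\<rangle> \<cdot> \<kappa> (G \<otimes> G) G \<cdot> T\<^sub>a (mult3 C G m) = (a \<star> b) \<star> c"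
    using Tmult_el_eq[OF Tmult_el_hom[OF a b] c] by (simp add: t_def)

  define bc' where "bc' = \<langle>\<pi>\<^sub>0 (G \<otimes> G) G \<cdot> \<pi>\<^sub>1 G G, \<pi>\<^sub>1 (G \<otimes> G) G\<rangle>"
  define assoc where "assoc = \<langle>\<pi>\<^sub>0 (G \<otimes> G) G \<cdot> \<pi>\<^sub>0 G G, bc'\<rangle>"
  have bc'_hom: "bc' \<in> hom C ((G \<otimes> G) \<otimes> G) (G \<otimes> G)"
    unfolding bc'_def by (rule pair_hom[OF comp_hom[OF Q(1) P(2)] Q(2)])
  have law: "mult3 C G m = assoc \<cdot> (\<id> G \<otimes>\<^sub>a m) \<cdot> m"
    using group by (simp add: group_object_def mult3_def assoc_def bc'_def Let_def)
  have "assoc \<cdot> (\<id> G \<otimes>\<^sub>a m) = \<langle>\<pi>\<^sub>0 (G \<otimes> G) G \<cdot> \<pi>\<^sub>0 G G, bc' \<cdot> m\<rangle>"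
    unfolding assoc_def
    using pair_prod_arr[OF comp_hom[OF Q(1) P(1)] bc'_hom i m_hom]
      comp_id[OF comp_hom[OF Q(1) P(1)]] by simp
  with law have law': "mult3 C G m = \<langle>\<pi>\<^sub>0 (G \<otimes> G) G \<cdot> \<pi>\<^sub>0 G G, bc' \<cdot> m\<rangle> \<cdot> m"
    by simp
  note k = pair_hom[OF comp_hom[OF Q(1) P(1)] comp_hom[OF bc'_hom m_hom]]
  have tbc: "t \<cdot> T\<^sub>a bc' = \<langle>b, c\<rangle> \<cdot> \<kappa> G G"
    unfolding bc'_def
    using comp_T_pair[OF t comp_hom[OF Q(1) P(2)] Q(2)] t0_comp[OF P(2)] t1
      Tpair_Pr1[OF a b G G] by simp
  have "t \<cdot> T\<^sub>a (bc' \<cdot> m) = b \<star> c"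
    using T_comp[OF bc'_hom m_hom] comp_assoc[OF t T_hom[OF bc'_hom] T_hom[OF m_hom]] tbc
      Tmult_el_eq[OF b c] by simp
  then have "t \<cdot> T\<^sub>a \<langle>\<pi>\<^sub>0 (G \<otimes> G) G \<cdot> \<pi>\<^sub>0 G G, bc' \<cdot> m\<rangle> = \<langle>a, b \<star> c\<rangle> \<cdot> \<kappa> G G"
    using comp_T_pair[OF t comp_hom[OF Q(1) P(1)] comp_hom[OF bc'_hom m_hom]] t0_comp[OF P(1)]
      Tpair_Pr0[OF a b G G] by simp
  then show "\<langle>\<langle>a, b\<rangle> \<cdot> \<kappa> G G, c\<rangle> \<cdot> \<kappa> (G \<otimes> G) G \<cdot> T\<^sub>a (mult3 C G m) = a \<star> (b \<star> c)"
    using law' T_comp[OF k m_hom] comp_assoc[OF t T_hom[OF k] T_hom[OF m_hom]]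
      Tmult_el_eq[OF a Tmult_el_hom[OF b c]] by (simp add: t_def)
qed

lemma Tmult_el_assoc:
  assumes "a \<in> hom C Z (T\<^sub>o G)" "b \<in> hom C Z (T\<^sub>o G)" "c \<in> hom C Z (T\<^sub>o G)"
  shows "(a \<star> b) \<star> c = a \<star> (b \<star> c)"
  using T_mult3_triple[OF assms] by simp

lemma Tmult3_hom: "Tmult3 C G m \<in> hom C ((T\<^sub>o G \<otimes> T\<^sub>o G) \<otimes> T\<^sub>o G) (T\<^sub>o G)"
proof -
  note G = G_obj
  note GG = Pr_hom(3)[OF G G]
  have "mult3 C G m \<in> hom C ((G \<otimes> G) \<otimes> G) G"
    unfolding mult3_def by (rule comp_hom[OF prod_arr_hom[OF m_hom id_hom[OF G]] m_hom])
  then show ?thesis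
    unfolding Tmult3_def
    by (rule comp_hom[OF comp_hom[OF prod_arr_hom[OF strength_hom[OF G G] id_hom[OF T_obj[OF G]]]
          strength_hom[OF GG G]] T_hom])
qed

lemma Tmult3_triple:
  assumes a: "a \<in> hom C Z (T\<^sub>o G)" and b: "b \<in> hom C Z (T\<^sub>o G)" and c: "c \<in> hom C Z (T\<^sub>o G)"
  shows "\<langle>\<langle>a, b\<rangle>, c\<rangle> \<cdot> Tmult3 C G m = (a \<star> b) \<star> c"
proof -
  note G = G_obj
  note GG = Pr_hom(3)[OF G G] and k = strength_hom[OF G G] and i = id_hom[OF T_obj[OF G]]
  note ab = pair_hom[OF a b]
  note abc = pair_hom[OF ab c] and ki = prod_arr_hom[OF k i] and k' = strength_hom[OF GG G]
  have m3: "mult3 C G m \<in> hom C ((G \<otimes> G) \<otimes> G) G"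
    unfolding mult3_def by (rule comp_hom[OF prod_arr_hom[OF m_hom id_hom[OF G]] m_hom])
  have "\<langle>\<langle>a, b\<rangle>, c\<rangle> \<cdot> Tmult3 C G m =
      \<langle>\<langle>a, b\<rangle>, c\<rangle> \<cdot> (\<kappa> G G \<otimes>\<^sub>a \<id> (T\<^sub>o G)) \<cdot> \<kappa> (G \<otimes> G) G \<cdot> T\<^sub>a (mult3 C G m)"
    unfolding Tmult3_def
    using comp_assoc[OF abc comp_hom[OF ki k'] T_hom[OF m3]] comp_assoc[OF abc ki k'] by simp
  also have "\<langle>\<langle>a, b\<rangle>, c\<rangle> \<cdot> (\<kappa> G G \<otimes>\<^sub>a \<id> (T\<^sub>o G)) = \<langle>\<langle>a, b\<rangle> \<cdot> \<kappa> G G, c\<rangle>"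
    using pair_prod_arr[OF ab c k i] comp_id[OF c] by simp
  finally show ?thesis
    using T_mult3_triple(1)[OF a b c] by simp
qed

text \<open>
  Naturality at \<open>m\<close> moves the zero section, and likewise the projection, from one side of the
  multiplication to \<open>G \<times> G\<close>, where compatibility with products makes it act componentwise. Hence
  both are homomorphisms.
\<close>

lemma zero_mult_el:
  assumes x: "x \<in> hom C Z G" and y: "y \<in> hom C Z G"
  shows "(x \<bullet> y) \<cdot> \<zero> G = (x \<cdot> \<zero> G) \<star> (y \<cdot> \<zero> G)"
proof -
  note G = G_obj
  note z = zero_hom[OF G] and xy = pair_hom[OF x y] and k = strength_hom[OF G G]
  note zGG = zero_hom[OF Pr_hom(3)[OF G G]] and zz = prod_arr_hom[OF z z]
  have "(x \<bullet> y) \<cdot> \<zero> G = \<langle>x, y\<rangle> \<cdot> \<zero> (G \<otimes> G) \<cdot> T\<^sub>a m"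
    using comp_assoc[OF xy m_hom z] comp_assoc[OF xy zGG T_hom[OF m_hom]] zero_nat[OF m_hom] by simp
  also have "\<langle>x, y\<rangle> \<cdot> \<zero> (G \<otimes> G) = \<langle>x, y\<rangle> \<cdot> (\<zero> G \<otimes>\<^sub>a \<zero> G) \<cdot> \<kappa> G G"
    using comp_assoc[OF xy zz k] strength_zero[OF G G] by simp
  also have "\<langle>x, y\<rangle> \<cdot> (\<zero> G \<otimes>\<^sub>a \<zero> G) = \<langle>x \<cdot> \<zero> G, y \<cdot> \<zero> G\<rangle>"
    by (rule pair_prod_arr[OF x y z z])
  finally show ?thesis
    using Tmult_el_eq[OF comp_hom[OF x z] comp_hom[OF y z]] by simp
qed

lemma tproj_Tmult_el:
  assumes a: "a \<in> hom C Z (T\<^sub>o G)" and b: "b \<in> hom C Z (T\<^sub>o G)"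
  shows "(a \<star> b) \<cdot> \<pp> G = (a \<cdot> \<pp> G) \<bullet> (b \<cdot> \<pp> G)"
proof -
  note G = G_obj
  note p = tproj_hom[OF G] and ab = pair_hom[OF a b] and k = strength_hom[OF G G]
  note pGG = tproj_hom[OF Pr_hom(3)[OF G G]] and abk = Tpair_hom[OF a b G G]
  have "(a \<star> b) \<cdot> \<pp> G = \<langle>a, b\<rangle> \<cdot> \<kappa> G G \<cdot> \<pp> (G \<otimes> G) \<cdot> m"
    using Tmult_el_eq[OF a b] comp_assoc[OF abk T_hom[OF m_hom] p] comp_assoc[OF abk pGG m_hom]
      tproj_nat[OF m_hom] by simp
  also have "\<langle>a, b\<rangle> \<cdot> \<kappa> G G \<cdot> \<pp> (G \<otimes> G) = \<langle>a, b\<rangle> \<cdot> (\<pp> G \<otimes>\<^sub>a \<pp> G)"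
    using comp_assoc[OF ab k pGG] strength_proj[OF G G] by simp
  also have "\<dots> = \<langle>a \<cdot> \<pp> G, b \<cdot> \<pp> G\<rangle>"
    by (rule pair_prod_arr[OF a b p p])
  finally show ?thesis .
qed

text \<open>
  Every map to \<open>T(1)\<close> is the zero vector because \<open>T(1)\<close> is terminal. Hence applying \<open>T\<close> to the unit
  law of \<open>m\<close> produces the zero vector at \<open>u\<close> as the unit.
\<close>

lemma Tmult_el_unit_left:
  assumes a: "a \<in> hom C Z (T\<^sub>o G)"
  shows "(\<e> Z \<cdot> \<zero> G) \<star> a = a"
proof -
  note G = G_obj
  note Z = hom_objs(1)[OF a] and e = unit_el_hom[OF G_obj] and i = id_hom[OF G_obj]
  note oG = to_one_hom[OF G] and z1 = zero_hom[OF one_obj]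
  note oZ = to_one_hom[OF Z]
  have "a \<cdot> T\<^sub>a (\<e> G) = a \<cdot> T\<^sub>a (to_one C G) \<cdot> T\<^sub>a u"
    using T_comp[OF oG u_hom] comp_assoc[OF a T_hom[OF oG] T_hom[OF u_hom]] by simp
  also have "a \<cdot> T\<^sub>a (to_one C G) = to_one C Z \<cdot> \<zero> \<one>"
    by (rule hom_T_one_unique[OF comp_hom[OF a T_hom[OF oG]] comp_hom[OF oZ z1]])
  also have "to_one C Z \<cdot> \<zero> \<one> \<cdot> T\<^sub>a u = \<e> Z \<cdot> \<zero> G"
    using comp_assoc[OF oZ z1 T_hom[OF u_hom]] comp_assoc[OF oZ u_hom zero_hom[OF G]]
      zero_nat[OF u_hom] by simp
  finally have "a \<cdot> T\<^sub>a \<langle>\<e> G, \<id> G\<rangle> = \<langle>\<e> Z \<cdot> \<zero> G, a\<rangle> \<cdot> \<kappa> G G"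
    using comp_T_pair[OF a e i] T_id[OF G] comp_id[OF a] by simp
  then have "(\<e> Z \<cdot> \<zero> G) \<star> a = a \<cdot> T\<^sub>a (\<langle>\<e> G, \<id> G\<rangle> \<cdot> m)"
    using Tmult_el_eq[OF comp_hom[OF unit_el_hom[OF Z] zero_hom[OF G]] a]
      comp_assoc[OF a T_hom[OF pair_hom[OF e i]] T_hom[OF m_hom]]
      T_comp[OF pair_hom[OF e i] m_hom] by simp
  also have "\<dots> = a"
    using group T_id[OF G] comp_id[OF a] by (simp add: group_object_def)
  finally show ?thesis .
qed

end


section \<open>The semidirect product law on the trivialized tangent group\<close>

locale tangent_group_fibre = tangent_group C G m u \<iota>
  for C :: "('o, 'a, 'm) cartesian_tangent_data_scheme" (structure)
    and G m u \<iota> +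
  fixes H :: 'o and q :: 'a
  assumes fibre: "fibre_at_unit C G u H q"
begin

lemma fibre_laws:
  shows H_obj: "H \<in> Obj C" and q_hom: "q \<in> hom C H (T\<^sub>o G)" and q_tproj: "q \<cdot> \<pp> G = \<e> H"
  using fibre tproj_hom[OF G_obj] by (auto simp: fibre_at_unit_def is_pullback_def hom_def)

text \<open>
  The leg of the cone at the terminal object imposes no condition, so an arrow into the pullback is
  an arrow into \<open>T(G)\<close> over \<open>u\<close>.
\<close>

lemma factor_q:
  assumes h: "h \<in> hom C Z (T\<^sub>o G)" and vert: "h \<cdot> \<pp> G = \<e> Z"
  shows "factor C q h \<in> hom C Z H" "factor C q h \<cdot> q = h"
proof -
  note Z = hom_objs(1)[OF h]
  have D: "Dom C u = \<one>" "Dom C (\<pp> G) = T\<^sub>o G" "Dom C h = Z" "Dom C q = H"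
    using u_hom tproj_hom[OF G_obj] h q_hom by (auto simp: hom_def)
  have "\<exists>!k. k \<in> hom C Z H \<and> k \<cdot> to_one C H = to_one C Z \<and> k \<cdot> q = h"
    using fibre to_one_hom[OF Z] h vert by (simp add: fibre_at_unit_def is_pullback_def D)
  moreover have "k \<cdot> to_one C H = to_one C Z" if "k \<in> hom C Z H" for k
    by (rule hom_one_unique[OF comp_hom[OF that to_one_hom[OF H_obj]] to_one_hom[OF Z]])
  ultimately have "\<exists>!k. k \<in> hom C Z H \<and> k \<cdot> q = h"
    by metis
  from theI'[OF this] show "factor C q h \<in> hom C Z H" "factor C q h \<cdot> q = h"
    by (simp_all add: factor_def D)
qed

lemma comp_q_tproj:
  assumes k: "k \<in> hom C Z H"
  shows "k \<cdot> q \<cdot> \<pp> G = \<e> Z"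
  using comp_assoc[OF k q_hom tproj_hom[OF G_obj]] q_tproj comp_unit_el[OF k] by simp

lemma Tmult_u_laws:
  shows Tmult_u_hom: "Tmult_u C G m q \<in> hom C (H \<otimes> H) H"
    and Tmult_u_q: "Tmult_u C G m q \<cdot> q = (q \<otimes>\<^sub>a q) \<cdot> Tmult C G m"
proof -
  note P = Pr_hom[OF H_obj H_obj]
  have eq: "(q \<otimes>\<^sub>a q) \<cdot> Tmult C G m = (\<pi>\<^sub>0 H H \<cdot> q) \<star> (\<pi>\<^sub>1 H H \<cdot> q)"
    using prod_arr_pair[OF q_hom q_hom] by simp
  note a = comp_hom[OF P(1) q_hom] and b = comp_hom[OF P(2) q_hom]
  have "((\<pi>\<^sub>0 H H \<cdot> q) \<star> (\<pi>\<^sub>1 H H \<cdot> q)) \<cdot> \<pp> G = \<e> (H \<otimes> H)"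
    using tproj_Tmult_el[OF a b] comp_q_tproj[OF P(1)] comp_q_tproj[OF P(2)]
      mult_el_unit[OF unit_el_hom[OF P(3)]] by simp
  from factor_q[OF Tmult_el_hom[OF a b] this]
  show "Tmult_u C G m q \<in> hom C (H \<otimes> H) H"
    "Tmult_u C G m q \<cdot> q = (q \<otimes>\<^sub>a q) \<cdot> Tmult C G m"
    by (simp_all add: Tmult_u_def eq)
qed

lemma pair_Tmult_u:
  assumes k: "k \<in> hom C Z H" and l: "l \<in> hom C Z H"
  shows "\<langle>k, l\<rangle> \<cdot> Tmult_u C G m q \<cdot> q = (k \<cdot> q) \<star> (l \<cdot> q)"
  using comp_assoc[OF pair_hom[OF k l] Tmult_u_hom q_hom] Tmult_u_q
    comp_assoc[OF pair_hom[OF k l] prod_arr_hom[OF q_hom q_hom] Tmult_hom]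
    pair_prod_arr[OF k l q_hom q_hom] by simp

lemma zero_el_tproj:
  assumes g: "g \<in> hom C Z G"
  shows "g \<cdot> \<zero> G \<cdot> \<pp> G = g"
  using comp_assoc[OF g zero_hom[OF G_obj] tproj_hom[OF G_obj]] zero_tproj[OF G_obj] comp_id[OF g]
  by simp

text \<open>
  Conjugating a vector over \<open>u\<close> by a zero vector gives a vector over \<open>g\<inverse> \<bullet> u \<bullet> g = u\<close>, so the
  conjugate does lift to \<open>H\<close>.
\<close>

lemma Ad_r_laws:
  shows Ad_r_hom: "Ad_r C G m \<iota> H q \<in> hom C (H \<otimes> G) H"
    and Ad_r_q: "Ad_r C G m \<iota> H q \<cdot> q =
      ((\<pi>\<^sub>1 H G \<cdot> \<iota> \<cdot> \<zero> G) \<star> (\<pi>\<^sub>0 H G \<cdot> q)) \<star> (\<pi>\<^sub>1 H G \<cdot> \<zero> G)"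
proof -
  note P = Pr_hom[OF H_obj G_obj] and z = zero_hom[OF G_obj]
  note gi = comp_hom[OF P(2) inv_hom]
  note a = comp_hom[OF gi z] and b = comp_hom[OF P(1) q_hom] and c = comp_hom[OF P(2) z]
  note ab = Tmult_el_hom[OF a b]
  have "(((\<pi>\<^sub>1 H G \<cdot> \<iota> \<cdot> \<zero> G) \<star> (\<pi>\<^sub>0 H G \<cdot> q)) \<star> (\<pi>\<^sub>1 H G \<cdot> \<zero> G)) \<cdot> \<pp> G
      = (\<pi>\<^sub>1 H G \<cdot> \<iota>) \<bullet> \<e> (H \<otimes> G) \<bullet> \<pi>\<^sub>1 H G"
    using tproj_Tmult_el[OF ab c] tproj_Tmult_el[OF a b] zero_el_tproj[OF gi]
      zero_el_tproj[OF P(2)] comp_q_tproj[OF P(1)] by simp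
  also have "\<dots> = \<e> (H \<otimes> G)"
    using mult_el_unit[OF gi] mult_el_inv_left[OF P(2)] by simp
  finally show "Ad_r C G m \<iota> H q \<in> hom C (H \<otimes> G) H"
    "Ad_r C G m \<iota> H q \<cdot> q = ((\<pi>\<^sub>1 H G \<cdot> \<iota> \<cdot> \<zero> G) \<star> (\<pi>\<^sub>0 H G \<cdot> q)) \<star> (\<pi>\<^sub>1 H G \<cdot> \<zero> G)"
    using factor_q[OF Tmult_el_hom[OF ab c]] by (simp_all add: Ad_r_def Tmult3_triple[OF a b c])
qed

lemma pair_Ad_r:
  assumes k: "k \<in> hom C Z H" and g: "g \<in> hom C Z G"
  shows "\<langle>k, g\<rangle> \<cdot> Ad_r C G m \<iota> H q \<cdot> q = ((g \<cdot> \<iota> \<cdot> \<zero> G) \<star> (k \<cdot> q)) \<star> (g \<cdot> \<zero> G)"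
proof -
  note P = Pr_hom[OF H_obj G_obj] and z = zero_hom[OF G_obj] and kg = pair_hom[OF k g]
  note gi = comp_hom[OF P(2) inv_hom]
  note a = comp_hom[OF gi z] and b = comp_hom[OF P(1) q_hom] and c = comp_hom[OF P(2) z]
  have "\<langle>k, g\<rangle> \<cdot> (\<pi>\<^sub>1 H G \<cdot> \<iota> \<cdot> \<zero> G) = g \<cdot> \<iota> \<cdot> \<zero> G" "\<langle>k, g\<rangle> \<cdot> (\<pi>\<^sub>0 H G \<cdot> q) = k \<cdot> q"
    "\<langle>k, g\<rangle> \<cdot> (\<pi>\<^sub>1 H G \<cdot> \<zero> G) = g \<cdot> \<zero> G"
    using comp_assoc[OF kg gi z] comp_assoc[OF kg P(2) inv_hom] comp_assoc[OF kg P(1) q_hom]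
      comp_assoc[OF kg P(2) z] pair_laws[OF k g] by simp_all
  then show ?thesis
    using comp_assoc[OF kg Ad_r_hom q_hom] Ad_r_q comp_Tmult_el[OF kg Tmult_el_hom[OF a b] c]
      comp_Tmult_el[OF kg a b] by simp
qed

lemma phi_inv_hom: "phi_inv C G m q \<in> hom C (G \<otimes> H) (T\<^sub>o G)"
  unfolding phi_inv_def
  by (rule comp_hom[OF prod_arr_hom[OF zero_hom[OF G_obj] q_hom] Tmult_hom])

lemma pair_phi_inv:
  assumes g: "g \<in> hom C Z G" and k: "k \<in> hom C Z H"
  shows "\<langle>g, k\<rangle> \<cdot> phi_inv C G m q = (g \<cdot> \<zero> G) \<star> (k \<cdot> q)"
  unfolding phi_inv_def
  using comp_assoc[OF pair_hom[OF g k] prod_arr_hom[OF zero_hom[OF G_obj] q_hom] Tmult_hom]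
    pair_prod_arr[OF g k zero_hom[OF G_obj] q_hom] by simp

text \<open>
  Zero vectors are invertible for \<open>\<star>\<close>, because the zero section is a homomorphism defined on a group.
  So conjugation lets any tangent vector pass from the left of a zero vector to its right.
\<close>

lemma zero_conjugate:
  assumes g: "g \<in> hom C Z G" and a: "a \<in> hom C Z (T\<^sub>o G)"
  shows "(g \<cdot> \<zero> G) \<star> (((g \<cdot> \<iota> \<cdot> \<zero> G) \<star> a) \<star> (g \<cdot> \<zero> G)) = a \<star> (g \<cdot> \<zero> G)"
proof -
  note z = zero_hom[OF G_obj]
  note x = comp_hom[OF g z] and y = comp_hom[OF comp_hom[OF g inv_hom] z]
  have "(g \<cdot> \<zero> G) \<star> (((g \<cdot> \<iota> \<cdot> \<zero> G) \<star> a) \<star> (g \<cdot> \<zero> G)) =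
      ((g \<cdot> \<zero> G) \<star> (g \<cdot> \<iota> \<cdot> \<zero> G)) \<star> a \<star> (g \<cdot> \<zero> G)"
    using Tmult_el_assoc[OF x Tmult_el_hom[OF y a] x] Tmult_el_assoc[OF x y a] by simp
  also have "(g \<cdot> \<zero> G) \<star> (g \<cdot> \<iota> \<cdot> \<zero> G) = \<e> Z \<cdot> \<zero> G"
    using zero_mult_el[OF g comp_hom[OF g inv_hom]] mult_el_inv_right[OF g] by simp
  finally show ?thesis
    using Tmult_el_unit_left[OF a] by simp
qed

text \<open>
  The equation of the theorem evaluated at an arbitrary pair \<open>((g, k), (g', k'))\<close> of generalized
  elements: moving \<open>g'\<close> to the left past \<open>k\<close> replaces \<open>k\<close> by its conjugate.
\<close>

lemma semidirect_law:
  assumes g: "g \<in> hom C Z G" and g': "g' \<in> hom C Z G"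
    and k: "k \<in> hom C Z H" and k': "k' \<in> hom C Z H"
  shows "\<langle>g \<bullet> g', \<langle>\<langle>k, g'\<rangle> \<cdot> Ad_r C G m \<iota> H q, k'\<rangle> \<cdot> Tmult_u C G m q\<rangle> \<cdot> phi_inv C G m q
    = (\<langle>g, k\<rangle> \<cdot> phi_inv C G m q) \<star> (\<langle>g', k'\<rangle> \<cdot> phi_inv C G m q)"
proof -
  note z = zero_hom[OF G_obj]
  define ad where "ad = \<langle>k, g'\<rangle> \<cdot> Ad_r C G m \<iota> H q"
  have ad: "ad \<in> hom C Z H"
    unfolding ad_def by (rule comp_hom[OF pair_hom[OF k g'] Ad_r_hom])
  note x = comp_hom[OF g z] and x' = comp_hom[OF g' z]
  note a = comp_hom[OF k q_hom] and a' = comp_hom[OF k' q_hom] and b = comp_hom[OF ad q_hom]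
  have conj: "(g' \<cdot> \<zero> G) \<star> (ad \<cdot> q) = (k \<cdot> q) \<star> (g' \<cdot> \<zero> G)"
    unfolding ad_def pair_Ad_r[OF k g'] by (rule zero_conjugate[OF g' a])
  have "\<langle>g \<bullet> g', \<langle>ad, k'\<rangle> \<cdot> Tmult_u C G m q\<rangle> \<cdot> phi_inv C G m q
      = ((g \<cdot> \<zero> G) \<star> (g' \<cdot> \<zero> G)) \<star> ((ad \<cdot> q) \<star> (k' \<cdot> q))"
    using pair_phi_inv[OF mult_el_hom[OF g g'] comp_hom[OF pair_hom[OF ad k'] Tmult_u_hom]]
      zero_mult_el[OF g g'] pair_Tmult_u[OF ad k'] by simp
  also have "\<dots> = (g \<cdot> \<zero> G) \<star> (((g' \<cdot> \<zero> G) \<star> (ad \<cdot> q)) \<star> (k' \<cdot> q))"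
    using Tmult_el_assoc[OF x x' Tmult_el_hom[OF b a']] Tmult_el_assoc[OF x' b a'] by simp
  also have "\<dots> = (g \<cdot> \<zero> G) \<star> ((k \<cdot> q) \<star> ((g' \<cdot> \<zero> G) \<star> (k' \<cdot> q)))"
    using conj Tmult_el_assoc[OF a x' a'] by simp
  also have "\<dots> = ((g \<cdot> \<zero> G) \<star> (k \<cdot> q)) \<star> ((g' \<cdot> \<zero> G) \<star> (k' \<cdot> q))"
    using Tmult_el_assoc[OF x a Tmult_el_hom[OF x' a']] by simp
  finally show ?thesis
    using pair_phi_inv[OF g k] pair_phi_inv[OF g' k'] by (simp add: ad_def)
qed

lemma pair_swap_Ad:
  assumes k: "k \<in> hom C Z H" and g: "g \<in> hom C Z G"
  shows "\<langle>k, g\<rangle> \<cdot> swap_Ad C G m \<iota> H q = \<langle>g, \<langle>k, g\<rangle> \<cdot> Ad_r C G m \<iota> H q\<rangle>"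
  unfolding swap_Ad_def
  using comp_pair[OF pair_hom[OF k g] Pr_hom(2)[OF H_obj G_obj] Ad_r_hom] pair_Pr1[OF k g] by simp

lemma swap_Ad_hom: "swap_Ad C G m \<iota> H q \<in> hom C (H \<otimes> G) (G \<otimes> H)"
  unfolding swap_Ad_def by (rule pair_hom[OF Pr_hom(2)[OF H_obj G_obj] Ad_r_hom])

end

theorem proposition4:
  fixes X :: "('o, 'a, 'm) cartesian_tangent_data_scheme" (structure)
    and G H :: 'o and m u \<iota> q :: 'a
  assumes "cartesian_tangent_category X"
    and "group_object X G m u \<iota>"
    and "fibre_at_unit X G u H q"
  shows "let \<phi>' = phi_inv X G m q; s = swap_Ad X G m \<iota> H q in
    (\<phi>' \<otimes>\<^sub>a \<phi>') \<cdot> Tmult X G m \<in> hom X ((G \<otimes> H) \<otimes> (G \<otimes> H)) (T\<^sub>o G) \<and>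
    (\<phi>' \<otimes>\<^sub>a \<phi>') \<cdot> Tmult X G m =
      regroup_middle X G H G H
        \<cdot> ((\<id> G \<otimes>\<^sub>a s) \<otimes>\<^sub>a \<id> H)
        \<cdot> regroup_pairs X G G H H
        \<cdot> (m \<otimes>\<^sub>a Tmult_u X G m q)
        \<cdot> \<phi>'"
proof -
  interpret tangent_group_fibre X G m u \<iota> H q
    using assms
    by (simp add: tangent_group_fibre_def tangent_group_def tangent_group_axioms_def
        tangent_group_fibre_axioms_def)
  define \<phi>' where "\<phi>' = phi_inv X G m q"
  define s where "s = swap_Ad X G m \<iota> H q"
  define Z where "Z = (G \<otimes> H) \<otimes> (G \<otimes> H)"
  \<comment> \<open>The generic element: the four coordinates of the domain.\<close>
  define l r where "l = \<pi>\<^sub>0 (G \<otimes> H) (G \<otimes> H)" and "r = \<pi>\<^sub>1 (G \<otimes> H) (G \<otimes> H)"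
  define g k g' k' where "g = l \<cdot> \<pi>\<^sub>0 G H" and "k = l \<cdot> \<pi>\<^sub>1 G H"
    and "g' = r \<cdot> \<pi>\<^sub>0 G H" and "k' = r \<cdot> \<pi>\<^sub>1 G H"
  define ad where "ad = \<langle>k, g'\<rangle> \<cdot> Ad_r X G m \<iota> H q"
  note P = Pr_hom[OF G_obj H_obj]
  have l: "l \<in> hom X Z (G \<otimes> H)" and r: "r \<in> hom X Z (G \<otimes> H)"
    unfolding l_def r_def Z_def by (rule Pr_hom[OF P(3) P(3)])+
  have g: "g \<in> hom X Z G" and k: "k \<in> hom X Z H" and g': "g' \<in> hom X Z G" and k': "k' \<in> hom X Z H"
    unfolding g_def k_def g'_def k'_def using comp_hom l r P by blast+
  have ad: "ad \<in> hom X Z H"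
    unfolding ad_def by (rule comp_hom[OF pair_hom[OF k g'] Ad_r_hom])
  have \<phi>': "\<phi>' \<in> hom X (G \<otimes> H) (T\<^sub>o G)"
    unfolding \<phi>'_def by (rule phi_inv_hom)
  have s: "s \<in> hom X (H \<otimes> G) (G \<otimes> H)"
    unfolding s_def by (rule swap_Ad_hom)
  have l_eq: "l = \<langle>g, k\<rangle>" and r_eq: "r = \<langle>g', k'\<rangle>"
    using pair_eqI[OF l G_obj H_obj] pair_eqI[OF r G_obj H_obj]
    by (simp_all add: g_def k_def g'_def k'_def)

  note i = id_hom[OF G_obj] and j = id_hom[OF H_obj]
  note is_hom = prod_arr_hom[OF i s]
  note kg = pair_hom[OF k g']
  have "regroup_middle X G H G H \<cdot> ((\<id> G \<otimes>\<^sub>a s) \<otimes>\<^sub>a \<id> H) = \<langle>\<langle>g, \<langle>g', ad\<rangle>\<rangle>, k'\<rangle>"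
    using pair_prod_arr[OF pair_hom[OF g kg] k' is_hom j] pair_prod_arr[OF g kg i s]
      comp_id[OF g] comp_id[OF k'] pair_swap_Ad[OF k g']
    by (simp add: regroup_middle_def Let_def ad_def s_def g_def k_def g'_def k'_def l_def r_def)
  then have "regroup_middle X G H G H \<cdot> ((\<id> G \<otimes>\<^sub>a s) \<otimes>\<^sub>a \<id> H) \<cdot> regroup_pairs X G G H H
      \<cdot> (m \<otimes>\<^sub>a Tmult_u X G m q) \<cdot> \<phi>' = \<langle>\<langle>g, g'\<rangle> \<cdot> m, \<langle>ad, k'\<rangle> \<cdot> Tmult_u X G m q\<rangle> \<cdot> \<phi>'"
    using pair_regroup_pairs[OF g g' ad k']
      pair_prod_arr[OF pair_hom[OF g g'] pair_hom[OF ad k'] m_hom Tmult_u_hom] by simp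
  also have "\<dots> = \<langle>\<langle>g, k\<rangle> \<cdot> \<phi>', \<langle>g', k'\<rangle> \<cdot> \<phi>'\<rangle> \<cdot> Tmult X G m"
    unfolding \<phi>'_def ad_def by (rule semidirect_law[OF g g' k k'])
  also have "\<dots> = (\<phi>' \<otimes>\<^sub>a \<phi>') \<cdot> Tmult X G m"
    using prod_arr_pair[OF \<phi>' \<phi>'] by (simp add: l_eq[symmetric] r_eq[symmetric] l_def r_def)
  finally show ?thesis
    using comp_hom[OF prod_arr_hom[OF \<phi>' \<phi>'] Tmult_hom]
    by (simp add: \<phi>'_def s_def Let_def)
qed

end
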